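(* Let $n=3$. Any two joint profiles for $3$ men and $3$ women that have the same key function $f$ can be obtained from each other by relabeling (permuting) the men and relabeling (permuting) the women. Consequently, the number of stable matchings of a joint profile with $n=3$ is determined by its key function.
   Context: A preference profile for $n$ men and $n$ women consists of a strict ranking (without ties) by each man of all $n$ women and by each woman of all $n$ men, with ranks $1,\dots,n$, where $1$ is the most preferred. A profile is called joint if there is a function $f:\{1,\dots,n\}\to\{1,\dots,n\}$, called the key, such that for every woman $w$ and every man $m$, if $w$ ranks $m$ as $i$, then $m$ ranks $w$ as $f(i)$. A matching is a perfect matching of men with women. A blocking pair for a matching is a man and a woman who are not matched to each other and who each prefer the other to their assigned partner. A matching is stable if it has no blocking pair. *)

theory Defs
  imports Main "HOL-Combinatorics.Permutations"
begin

text \<open>Both the men and the women are labelled \<open>1, \<dots>, n\<close>; \<open>man_rank P m w\<close> is the rank that man \<open>m\<close>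
  gives to woman \<open>w\<close>, and \<open>woman_rank P w m\<close> the rank that woman \<open>w\<close> gives to man \<open>m\<close>. Values
  outside \<open>{1..n}\<close> are never inspected.\<close>

record profile =
  man_rank :: "nat \<Rightarrow> nat \<Rightarrow> nat"
  woman_rank :: "nat \<Rightarrow> nat \<Rightarrow> nat"

definition preference_profile :: "nat \<Rightarrow> profile \<Rightarrow> bool" where
  "preference_profile n P \<longleftrightarrow>
     (\<forall>m\<in>{1..n}. bij_betw (man_rank P m) {1..n} {1..n}) \<and>
     (\<forall>w\<in>{1..n}. bij_betw (woman_rank P w) {1..n} {1..n})"

definition is_key :: "nat \<Rightarrow> profile \<Rightarrow> (nat \<Rightarrow> nat) \<Rightarrow> bool" where
  "is_key n P f \<longleftrightarrow>
     f ` {1..n} \<subseteq> {1..n} \<and>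
     (\<forall>w\<in>{1..n}. \<forall>m\<in>{1..n}. \<forall>i\<in>{1..n}. woman_rank P w m = i \<longrightarrow> man_rank P m w = f i)"

definition joint_profile :: "nat \<Rightarrow> profile \<Rightarrow> bool" where
  "joint_profile n P \<longleftrightarrow> preference_profile n P \<and> (\<exists>f. is_key n P f)"

text \<open>A matching is a set of pairs (man, woman).\<close>

definition perfect_matching :: "nat \<Rightarrow> (nat \<times> nat) set \<Rightarrow> bool" where
  "perfect_matching n \<mu> \<longleftrightarrow>
     \<mu> \<subseteq> {1..n} \<times> {1..n} \<and>
     (\<forall>m\<in>{1..n}. \<exists>!w. (m, w) \<in> \<mu>) \<and>
     (\<forall>w\<in>{1..n}. \<exists>!m. (m, w) \<in> \<mu>)"

definition blocking_pair :: "nat \<Rightarrow> profile \<Rightarrow> (nat \<times> nat) set \<Rightarrow> nat \<Rightarrow> nat \<Rightarrow> bool" where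
  "blocking_pair n P \<mu> m w \<longleftrightarrow>
     m \<in> {1..n} \<and> w \<in> {1..n} \<and> (m, w) \<notin> \<mu> \<and>
     (\<exists>w'. (m, w') \<in> \<mu> \<and> man_rank P m w < man_rank P m w') \<and>
     (\<exists>m'. (m', w) \<in> \<mu> \<and> woman_rank P w m < woman_rank P w m')"

definition stable_matching :: "nat \<Rightarrow> profile \<Rightarrow> (nat \<times> nat) set \<Rightarrow> bool" where
  "stable_matching n P \<mu> \<longleftrightarrow>
     perfect_matching n \<mu> \<and> (\<nexists>m w. blocking_pair n P \<mu> m w)"

definition num_stable_matchings :: "nat \<Rightarrow> profile \<Rightarrow> nat" where
  "num_stable_matchings n P = card {\<mu>. stable_matching n P \<mu>}"

text \<open>\<open>Q\<close> arises from \<open>P\<close> by renaming each man \<open>m\<close> to \<open>\<sigma> m\<close> and each woman \<open>w\<close> to \<open>\<tau> w\<close>.\<close>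

definition is_relabeling ::
  "nat \<Rightarrow> (nat \<Rightarrow> nat) \<Rightarrow> (nat \<Rightarrow> nat) \<Rightarrow> profile \<Rightarrow> profile \<Rightarrow> bool" where
  "is_relabeling n \<sigma> \<tau> P Q \<longleftrightarrow>
     \<sigma> permutes {1..n} \<and> \<tau> permutes {1..n} \<and>
     (\<forall>m\<in>{1..n}. \<forall>w\<in>{1..n}.
        man_rank Q (\<sigma> m) (\<tau> w) = man_rank P m w \<and>
        woman_rank Q (\<tau> w) (\<sigma> m) = woman_rank P w m)"

end

theory Submission
  imports Defs
begin

text \<open>
  Because the rankings of a man are the key applied to the ranks that the women give him, those
  ranks must be pairwise distinct: the women's ranks form a Latin square, with the women as rows and
  the men as columns (\<open>column_bij\<close>). Since the key recovers the men's ranks, it is enough to match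
  the two Latin squares of order 3 by permuting rows and columns, leaving the symbols alone.

  Permute the columns of the second square so that the first rows agree, then its rows so
  that the first columns agree too (\<open>match_bijections\<close>). Every later row is now, in both squares, a
  derangement of the same first row, and the two derangements have the same first entry. A
  derangement of three letters is a 3-cycle, determined by one of its values, so the rows coincide
  (\<open>derangements_of_three_eqI\<close>).

  The count of stable matchings is invariant because a relabeling carries stable matchings
  injectively to stable matchings, and so does the inverse relabeling.
\<close>

lemma match_bijections:
  assumes "bij_betw g S T" and "bij_betw h S T"
  obtains \<pi> where "\<pi> permutes S" and "\<And>x. x \<in> S \<Longrightarrow> h (\<pi> x) = g x"
proof -
  define \<pi> where "\<pi> x = (if x \<in> S then inv_into S h (g x) else x)" for x
  have "bij_betw (inv_into S h \<circ> g) S S"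
    using assms by (blast intro: bij_betw_trans bij_betw_inv_into)
  then have "bij_betw \<pi> S S"
    by (rule bij_betw_cong[THEN iffD1, rotated]) (simp add: \<pi>_def)
  then have "\<pi> permutes S"
    by (rule bij_imp_permutes) (simp add: \<pi>_def)
  moreover have "h (\<pi> x) = g x" if "x \<in> S" for x
  proof -
    have "g x \<in> h ` S" using that assms by (auto simp: bij_betw_def)
    then show ?thesis using that by (simp add: \<pi>_def f_inv_into_f)
  qed
  ultimately show thesis by (rule that)
qed

section \<open>Latin squares of order 3\<close>

text \<open>
  The letter \<open>p 1\<close> is \<open>r 2\<close> or \<open>r 3\<close>, say \<open>r 2\<close>. The letters left for the positions 2 and 3 are
  then \<open>r 1\<close> and \<open>r 3\<close>, and since \<open>r 3\<close> is barred from position 3 it goes to position 2; the other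
  case is symmetric.
\<close>
lemma derangements_of_three_eqI:
  fixes p q r :: "nat \<Rightarrow> nat"
  assumes "bij_betw p {1..3} {1..3}" and "bij_betw q {1..3} {1..3}" and "bij_betw r {1..3} {1..3}"
    and "\<And>x. x \<in> {1..3} \<Longrightarrow> p x \<noteq> r x" and "\<And>x. x \<in> {1..3} \<Longrightarrow> q x \<noteq> r x"
    and "p 1 = q 1" and "x \<in> {1..3}"
  shows "p x = q x"
proof -
  have three: "{1..3} = {1, 2, 3 :: nat}" by auto
  have letters: "h 1 \<noteq> h 2 \<and> h 1 \<noteq> h 3 \<and> h 2 \<noteq> h 3 \<and>
      {h 1, h 2, h 3} = {1, 2, 3}" if "bij_betw h {1..3} {1..3}" for h :: "nat \<Rightarrow> nat"
    using that unfolding bij_betw_def three by (auto simp: inj_on_def)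
  have r: "r 1 \<noteq> r 2" "r 1 \<noteq> r 3" "r 2 \<noteq> r 3" "{r 1, r 2, r 3} = {1, 2, 3}"
    using letters[OF assms(3)] by auto
  have one: "h 2 = (if h 1 = r 2 then r 3 else r 1) \<and> h 3 = (if h 1 = r 2 then r 1 else r 2)"
    if h: "bij_betw h {1..3} {1..3}" and d: "\<And>x. x \<in> {1..3} \<Longrightarrow> h x \<noteq> r x" for h
  proof -
    have "h 1 \<in> {r 1, r 2, r 3}" "h 2 \<in> {r 1, r 2, r 3}" "h 3 \<in> {r 1, r 2, r 3}"
      using letters[OF h] r(4) by blast+
    moreover have "h 1 \<noteq> r 1" "h 2 \<noteq> r 2" "h 3 \<noteq> r 3" using d by auto
    moreover have "h 1 \<noteq> h 2" "h 1 \<noteq> h 3" "h 2 \<noteq> h 3" using letters[OF h] by blast+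
    ultimately show ?thesis using r(1-3) by (metis empty_iff insert_iff)
  qed
  have "p 2 = q 2" "p 3 = q 3"
    using one[OF assms(1,4)] one[OF assms(2,5)] \<open>p 1 = q 1\<close> by simp_all
  then show ?thesis using \<open>x \<in> {1..3}\<close> \<open>p 1 = q 1\<close> unfolding three by auto
qed

lemma latin_squares_of_three_matching:
  fixes A B :: "nat \<Rightarrow> nat \<Rightarrow> nat"
  assumes rowA: "\<And>w. w \<in> {1..3} \<Longrightarrow> bij_betw (A w) {1..3} {1..3}"
    and colA: "\<And>m. m \<in> {1..3} \<Longrightarrow> bij_betw (\<lambda>w. A w m) {1..3} {1..3}"
    and rowB: "\<And>w. w \<in> {1..3} \<Longrightarrow> bij_betw (B w) {1..3} {1..3}"
    and colB: "\<And>m. m \<in> {1..3} \<Longrightarrow> bij_betw (\<lambda>w. B w m) {1..3} {1..3}"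
  obtains \<sigma> \<tau> where "\<sigma> permutes {1..3}" and "\<tau> permutes {1..3}"
    and "\<And>w m. w \<in> {1..3} \<Longrightarrow> m \<in> {1..3} \<Longrightarrow> B (\<tau> w) (\<sigma> m) = A w m"
proof -
  have one: "1 \<in> {1..3::nat}" by simp
  obtain \<sigma> where \<sigma>: "\<sigma> permutes {1..3}" and row1: "\<And>m. m \<in> {1..3} \<Longrightarrow> B 1 (\<sigma> m) = A 1 m"
    using match_bijections[OF rowA[OF one] rowB[OF one]] by blast
  have \<sigma>_in: "\<sigma> m \<in> {1..3}" if "m \<in> {1..3}" for m
    using permutes_in_image[OF \<sigma>] that by blast
  obtain \<tau> where \<tau>: "\<tau> permutes {1..3}"
    and col1: "\<And>w. w \<in> {1..3} \<Longrightarrow> B (\<tau> w) (\<sigma> 1) = A w 1"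
    using match_bijections[OF colA[OF one] colB[OF \<sigma>_in[OF one]]] by blast
  have \<tau>_in: "\<tau> w \<in> {1..3}" if "w \<in> {1..3}" for w
    using permutes_in_image[OF \<tau>] that by blast
  \<comment> \<open>Matching the first columns leaves the first row in place, since the corner already agrees.\<close>
  have \<tau>1: "\<tau> 1 = 1"
    using inj_onD[OF bij_betw_imp_inj_on[OF colB[OF \<sigma>_in[OF one]]], of "\<tau> 1" 1]
      \<tau>_in[OF one] col1[OF one] row1[OF one] one by simp
  have eq: "B (\<tau> w) (\<sigma> m) = A w m" if w: "w \<in> {1..3}" and m: "m \<in> {1..3}" for w m
  proof (cases "w = 1")
    case True
    then show ?thesis using row1[OF m] \<tau>1 by simp
  next
    case False
    then have \<tau>w: "\<tau> w \<noteq> 1"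
      using \<tau>1 permutes_inj[OF \<tau>] by (metis injD)
    have bij: "bij_betw (\<lambda>m. B (\<tau> w) (\<sigma> m)) {1..3} {1..3}"
      using bij_betw_trans[OF permutes_imp_bij[OF \<sigma>] rowB[OF \<tau>_in[OF w]]] by (simp add: o_def)
    show ?thesis
    proof (rule derangements_of_three_eqI[OF bij rowA[OF w] rowA[OF one] _ _ col1[OF w] m])
      fix x :: nat assume x: "x \<in> {1..3}"
      show "B (\<tau> w) (\<sigma> x) \<noteq> A 1 x"
        using inj_onD[OF bij_betw_imp_inj_on[OF colB[OF \<sigma>_in[OF x]]] _ \<tau>_in[OF w] one]
          \<tau>w row1[OF x] by auto
      show "A w x \<noteq> A 1 x"
        using inj_onD[OF bij_betw_imp_inj_on[OF colA[OF x]] _ w one] False by auto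
    qed
  qed
  show thesis by (rule that[OF \<sigma> \<tau> eq])
qed

section \<open>Joint profiles as Latin squares\<close>

lemma key_rank:
  assumes "preference_profile n P" and "is_key n P f" and "m \<in> {1..n}" and "w \<in> {1..n}"
  shows "man_rank P m w = f (woman_rank P w m)"
proof -
  have "woman_rank P w m \<in> {1..n}"
    using assms bij_betwE unfolding preference_profile_def by blast
  then show ?thesis using assms unfolding is_key_def by blast
qed

text \<open>
  Two women giving the same man the same rank would, through the key, receive the same rank from
  him, although his ranking has no ties.
\<close>
lemma column_bij:
  assumes P: "preference_profile n P" and f: "is_key n P f" and m: "m \<in> {1..n}"
  shows "bij_betw (\<lambda>w. woman_rank P w m) {1..n} {1..n}"
proof -
  have inj: "inj_on (man_rank P m) {1..n}"
    using P m unfolding preference_profile_def bij_betw_def by blast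
  have "inj_on (\<lambda>w. woman_rank P w m) {1..n}"
  proof (rule inj_onI)
    fix v w assume v: "v \<in> {1..n}" and w: "w \<in> {1..n}" and "woman_rank P v m = woman_rank P w m"
    then have "man_rank P m v = man_rank P m w"
      using key_rank[OF P f m v] key_rank[OF P f m w] by simp
    then show "v = w" using inj v w by (blast dest: inj_onD)
  qed
  moreover have "(\<lambda>w. woman_rank P w m) ` {1..n} \<subseteq> {1..n}"
    using P m bij_betwE unfolding preference_profile_def by blast
  ultimately show ?thesis
    by (simp add: bij_betw_def endo_inj_surj)
qed

lemma joint_profiles_of_three_relabeling:
  assumes P: "preference_profile 3 P" "is_key 3 P f"
    and Q: "preference_profile 3 Q" "is_key 3 Q f"
  shows "\<exists>\<sigma> \<tau>. is_relabeling 3 \<sigma> \<tau> P Q"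
proof -
  have rows: "bij_betw (woman_rank R w) {1..3} {1..3}"
    if "preference_profile 3 R" "w \<in> {1..3}" for R w
    using that unfolding preference_profile_def by blast
  obtain \<sigma> \<tau> where \<sigma>: "\<sigma> permutes {1..3}" and \<tau>: "\<tau> permutes {1..3}"
    and eq: "\<And>w m. w \<in> {1..3} \<Longrightarrow> m \<in> {1..3} \<Longrightarrow> woman_rank Q (\<tau> w) (\<sigma> m) = woman_rank P w m"
    using latin_squares_of_three_matching[OF rows[OF P(1)] column_bij[OF P] rows[OF Q(1)] column_bij[OF Q]]
    by blast
  have "man_rank Q (\<sigma> m) (\<tau> w) = man_rank P m w" if "m \<in> {1..3}" "w \<in> {1..3}" for m w
    using key_rank[OF P that] key_rank[OF Q, of "\<sigma> m" "\<tau> w"] eq[OF that(2,1)]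
      permutes_in_image[OF \<sigma>, of m] permutes_in_image[OF \<tau>, of w] that by simp
  then show ?thesis using \<sigma> \<tau> eq unfolding is_relabeling_def by blast
qed

section \<open>Invariance of the number of stable matchings\<close>

lemma is_relabeling_inv:
  assumes "is_relabeling n \<sigma> \<tau> P Q"
  shows "is_relabeling n (inv \<sigma>) (inv \<tau>) Q P"
proof -
  have \<sigma>: "\<sigma> permutes {1..n}" and \<tau>: "\<tau> permutes {1..n}"
    using assms unfolding is_relabeling_def by auto
  have "man_rank P (inv \<sigma> m) (inv \<tau> w) = man_rank Q m w \<and>
      woman_rank P (inv \<tau> w) (inv \<sigma> m) = woman_rank Q w m"
    if "m \<in> {1..n}" "w \<in> {1..n}" for m w
  proof -
    have "inv \<sigma> m \<in> {1..n}" "inv \<tau> w \<in> {1..n}"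
      using that permutes_in_image[OF permutes_inv[OF \<sigma>]] permutes_in_image[OF permutes_inv[OF \<tau>]]
      by blast+
    then show ?thesis
      using assms permutes_inverses(1)[OF \<sigma>, of m] permutes_inverses(1)[OF \<tau>, of w]
      unfolding is_relabeling_def by metis
  qed
  then show ?thesis
    using permutes_inv[OF \<sigma>] permutes_inv[OF \<tau>] unfolding is_relabeling_def by blast
qed

lemma perfect_matching_image:
  assumes \<sigma>: "\<sigma> permutes {1..n}" and \<tau>: "\<tau> permutes {1..n}" and \<mu>: "perfect_matching n \<mu>"
  shows "perfect_matching n (map_prod \<sigma> \<tau> ` \<mu>)"
proof -
  have mem: "(m, w) \<in> map_prod \<sigma> \<tau> ` \<mu> \<longleftrightarrow> (inv \<sigma> m, inv \<tau> w) \<in> \<mu>" for m w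
  proof
    assume "(m, w) \<in> map_prod \<sigma> \<tau> ` \<mu>"
    then show "(inv \<sigma> m, inv \<tau> w) \<in> \<mu>"
      by (auto simp: permutes_inverses[OF \<sigma>] permutes_inverses[OF \<tau>])
  next
    assume "(inv \<sigma> m, inv \<tau> w) \<in> \<mu>"
    then have "map_prod \<sigma> \<tau> (inv \<sigma> m, inv \<tau> w) \<in> map_prod \<sigma> \<tau> ` \<mu>" by (rule imageI)
    then show "(m, w) \<in> map_prod \<sigma> \<tau> ` \<mu>"
      by (simp only: map_prod_simp permutes_inverses[OF \<sigma>] permutes_inverses[OF \<tau>])
  qed
  have "\<mu> \<subseteq> {1..n} \<times> {1..n}" using \<mu> unfolding perfect_matching_def by blast
  then have sub: "map_prod \<sigma> \<tau> ` \<mu> \<subseteq> {1..n} \<times> {1..n}"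
    by (metis map_prod_surj_on image_mono permutes_image[OF \<sigma>] permutes_image[OF \<tau>])
  have "\<exists>!w. (m, w) \<in> map_prod \<sigma> \<tau> ` \<mu>" if "m \<in> {1..n}" for m
  proof -
    have "inv \<sigma> m \<in> {1..n}" using that permutes_in_image[OF permutes_inv[OF \<sigma>]] by blast
    then have "\<exists>!w. (inv \<sigma> m, w) \<in> \<mu>" using \<mu> unfolding perfect_matching_def by blast
    then show ?thesis unfolding mem by (metis permutes_inverses[OF \<tau>])
  qed
  moreover have "\<exists>!m. (m, w) \<in> map_prod \<sigma> \<tau> ` \<mu>" if "w \<in> {1..n}" for w
  proof -
    have "inv \<tau> w \<in> {1..n}" using that permutes_in_image[OF permutes_inv[OF \<tau>]] by blast
    then have "\<exists>!m. (m, inv \<tau> w) \<in> \<mu>" using \<mu> unfolding perfect_matching_def by blast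
    then show ?thesis unfolding mem by (metis permutes_inverses[OF \<sigma>])
  qed
  ultimately show ?thesis
    unfolding perfect_matching_def by (intro conjI ballI sub)
qed

lemma stable_matching_image:
  assumes rel: "is_relabeling n \<sigma> \<tau> P Q" and \<mu>: "stable_matching n P \<mu>"
  shows "stable_matching n Q (map_prod \<sigma> \<tau> ` \<mu>)"
proof -
  have \<sigma>: "\<sigma> permutes {1..n}" and \<tau>: "\<tau> permutes {1..n}"
    using rel unfolding is_relabeling_def by auto
  have sub: "\<mu> \<subseteq> {1..n} \<times> {1..n}"
    using \<mu> unfolding stable_matching_def perfect_matching_def by blast
  have "\<not> blocking_pair n Q (map_prod \<sigma> \<tau> ` \<mu>) m w" for m w
  proof
    assume b: "blocking_pair n Q (map_prod \<sigma> \<tau> ` \<mu>) m w"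
    define a c where "a = inv \<sigma> m" and "c = inv \<tau> w"
    have m: "m = \<sigma> a" and w: "w = \<tau> c"
      using permutes_inverses[OF \<sigma>] permutes_inverses[OF \<tau>] by (simp_all add: a_def c_def)
    have ac: "a \<in> {1..n}" "c \<in> {1..n}"
      using b permutes_in_image[OF \<sigma>] permutes_in_image[OF \<tau>]
      unfolding blocking_pair_def m w by auto
    have ranks: "man_rank Q (\<sigma> x) (\<tau> y) = man_rank P x y"
        "woman_rank Q (\<tau> y) (\<sigma> x) = woman_rank P y x" if "x \<in> {1..n}" "y \<in> {1..n}" for x y
      using rel that unfolding is_relabeling_def by blast+
    have notin: "(a, c) \<notin> \<mu>"
      using b unfolding blocking_pair_def m w by force
    obtain c' where c': "(a, c') \<in> \<mu>" "man_rank Q (\<sigma> a) (\<tau> c) < man_rank Q (\<sigma> a) (\<tau> c')"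
      using b injD[OF permutes_inj[OF \<sigma>]] unfolding blocking_pair_def m w by auto
    obtain a' where a': "(a', c) \<in> \<mu>" "woman_rank Q (\<tau> c) (\<sigma> a) < woman_rank Q (\<tau> c) (\<sigma> a')"
      using b injD[OF permutes_inj[OF \<tau>]] unfolding blocking_pair_def m w by auto
    have "c' \<in> {1..n}" "a' \<in> {1..n}" using sub c'(1) a'(1) by auto
    then have "blocking_pair n P \<mu> a c"
      using ac notin c' a' ranks unfolding blocking_pair_def by auto
    then show False using \<mu> unfolding stable_matching_def by blast
  qed
  then show ?thesis
    using \<mu> perfect_matching_image[OF \<sigma> \<tau>] unfolding stable_matching_def by blast
qed

lemma num_stable_matchings_le:
  assumes rel: "is_relabeling n \<sigma> \<tau> P Q"
  shows "num_stable_matchings n P \<le> num_stable_matchings n Q"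
proof -
  have "inj \<sigma>" and "inj \<tau>"
    using rel unfolding is_relabeling_def by (blast dest: permutes_inj)+
  then have inj: "inj (map_prod \<sigma> \<tau>)" by (rule prod.inj_map)
  have "inj_on ((`) (map_prod \<sigma> \<tau>)) {\<mu>. stable_matching n P \<mu>}"
    by (rule inj_onI) (simp add: inj_image_eq_iff[OF inj])
  moreover have "(`) (map_prod \<sigma> \<tau>) ` {\<mu>. stable_matching n P \<mu>} \<subseteq> {\<mu>. stable_matching n Q \<mu>}"
    using stable_matching_image[OF rel] by blast
  moreover have "finite {\<mu>. stable_matching n Q \<mu>}"
    by (rule finite_subset[of _ "Pow ({1..n} \<times> {1..n})"])
      (auto simp: stable_matching_def perfect_matching_def)
  ultimately show ?thesis unfolding num_stable_matchings_def by (rule card_inj_on_le)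
qed

theorem mainTheorem3:
  fixes P Q :: profile and f :: "nat \<Rightarrow> nat"
  assumes "joint_profile 3 P" and "is_key 3 P f"
    and "joint_profile 3 Q" and "is_key 3 Q f"
  shows "(\<exists>\<sigma> \<tau>. is_relabeling 3 \<sigma> \<tau> P Q) \<and>
         num_stable_matchings 3 P = num_stable_matchings 3 Q"
proof -
  obtain \<sigma> \<tau> where rel: "is_relabeling 3 \<sigma> \<tau> P Q"
    using joint_profiles_of_three_relabeling[OF _ assms(2) _ assms(4)] assms(1,3)
    unfolding joint_profile_def by blast
  then show ?thesis
    using num_stable_matchings_le[OF rel] num_stable_matchings_le[OF is_relabeling_inv[OF rel]]
    by auto
qed

end
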